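(* Let $X=(X_n)_{n\ge 0}$ be a Galton-Watson process with $X_0=1$ and family-size distribution $\hat\pi$ (a probability measure on $\mathbb{N}_0$), and let $\hat\nu_n(j)=\mathbb{P}\{X_n=j\}$. Let $C=(C_n)_{n\ge0}$ be the discrete coagulation process with merger distribution equal to $\hat\pi$, and let $\nu_n(j)=\mathbb{P}\{C_n(i)=j\}$ (independent of $i\in\mathbb{N}$). Then for each $n\ge0$, $X_n$ has the same distribution as $C_n(i)$, $i\in\mathbb{N}$; that is, $\hat\nu_n=\nu_n$ for all $n\ge0$. Consequently, if $X$ is critical, i.e. $\sum_{k\ge0}k\hat\pi(k)=1$, then for all $n\ge0$ and all integers $j>0$, $$\hat\nu_{n+1}(j)-\hat\nu_n(j)=\sum_{k\ge2}\hat R_k(\rho_n)\,\hat I_k(\hat\nu_n,j),$$ where $$\rho_n=\sum_{j>0}\hat\nu_n(j),\qquad \hat R_k(\rho_n)=\sum_{l\ge k}\hat\pi(l)\binom{l}{k}\rho_n^k(1-\rho_n)^{l-k},$$ $$\hat I_k(\hat\nu_n,j)=\sum_{i_1,\dots,i_k>0}\Big[\delta^j\Big(\sum_{l=1}^k i_l\Big)-\sum_{l=1}^k\delta^j(i_l)\Big]\frac{\hat\nu_n(i_1)}{\rho_n}\cdots\frac{\hat\nu_n(i_k)}{\rho_n}.$$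
   Context: $\mathbb{N}=\{1,2,\dots\}$, $\mathbb{N}_0=\mathbb{N}\cup\{0\}$. $\delta^j(k)=1$ if $k=j$ and $0$ otherwise. Galton-Watson process: $X_{n+1}=\sum_{k=1}^{X_n}\xi_{k,n+1}$ with $\{\xi_{i,j}\}$ independent, identically distributed with law $\hat\pi$. Coagulation process: let $\hat\pi$ be a probability measure on $\mathbb{N}_0$ (the merger distribution). For each $n\in\mathbb{N}_0$, $C_n$ is a random function from $\mathbb{N}$ to $\mathbb{N}_0$. Initially $C_0(j)=1$ for all $j\in\mathbb{N}$. Given $C_n$, choose a random sequence $(M_{k,n})_{k\in\mathbb{N}_0}$ independent of $C_m$, $0\le m\le n$, with $M_{0,n}=0$ and with increments $M_{k+1,n}-M_{k,n}\in\mathbb{N}_0$ that are independent and identically distributed with law $\hat\pi$, and set $$C_{n+1}(j)=\sum_{i=1+M_{j-1,n}}^{M_{j,n}}C_n(i),$$ the sum being $0$ if $M_{j,n}=M_{j-1,n}$. For each $n$, the variables $C_n(i)$, $i\in\mathbb{N}$, are independent and identically distributed. *)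

theory Defs
  imports "HOL-Probability.Probability"
begin

locale galton_watson = prob_space M
  for M :: "'a measure" +
  fixes p :: "nat pmf"
    and \<xi> :: "nat \<Rightarrow> nat \<Rightarrow> 'a \<Rightarrow> nat"
    and X :: "nat \<Rightarrow> 'a \<Rightarrow> nat"
  assumes offspring_indep:
      "indep_vars (\<lambda>_. count_space UNIV) (\<lambda>(k, n). \<xi> k n) ({1..} \<times> {1..})"
    and offspring_law:
      "\<And>k n. k \<ge> 1 \<Longrightarrow> n \<ge> 1 \<Longrightarrow> distr M (count_space UNIV) (\<xi> k n) = measure_pmf p"
    and X_0: "\<And>\<omega>. \<omega> \<in> space M \<Longrightarrow> X 0 \<omega> = 1"
    and X_Suc: "\<And>n \<omega>. \<omega> \<in> space M \<Longrightarrow> X (Suc n) \<omega> = (\<Sum>k=1..X n \<omega>. \<xi> k (Suc n) \<omega>)"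

text \<open>The \<open>\<sigma>\<close>-algebra on \<open>\<Omega>\<close> generated by the discrete-valued family \<open>(Y i)\<close>, \<open>i \<in> I\<close>.\<close>

definition generated_events :: "'a set \<Rightarrow> ('i \<Rightarrow> 'a \<Rightarrow> nat) \<Rightarrow> 'i set \<Rightarrow> 'a set set" where
  "generated_events \<Omega> Y I = sigma_sets \<Omega> (\<Union>i\<in>I. {Y i -` A \<inter> \<Omega> | A. True})"

text \<open>\<open>S k n\<close> is the random sequence usually written \<open>M\<^sub>k\<^sub>,\<^sub>n\<close>. It is assumed nondecreasing in
  \<open>k\<close>, so that the truncated subtractions below are the true increments. The values \<open>C n 0\<close> carry
  no meaning: \<open>C n\<close> is a function on the positive integers. The set-valued \<open>indep_set\<close> is used
  because \<open>indep_var\<close> needs both variables to have the same type; it also requires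
  both families of events to be measurable.\<close>

locale coagulation = prob_space M
  for M :: "'a measure" +
  fixes p :: "nat pmf"
    and S :: "nat \<Rightarrow> nat \<Rightarrow> 'a \<Rightarrow> nat"
    and C :: "nat \<Rightarrow> nat \<Rightarrow> 'a \<Rightarrow> nat"
  assumes C_0: "\<And>j \<omega>. j \<ge> 1 \<Longrightarrow> \<omega> \<in> space M \<Longrightarrow> C 0 j \<omega> = 1"
    and S_0: "\<And>n \<omega>. \<omega> \<in> space M \<Longrightarrow> S 0 n \<omega> = 0"
    and S_mono: "\<And>k n \<omega>. \<omega> \<in> space M \<Longrightarrow> S k n \<omega> \<le> S (Suc k) n \<omega>"
    and increments_indep:
      "\<And>n. indep_vars (\<lambda>_. count_space UNIV) (\<lambda>k \<omega>. S (Suc k) n \<omega> - S k n \<omega>) UNIV"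
    and increments_law:
      "\<And>k n. distr M (count_space UNIV) (\<lambda>\<omega>. S (Suc k) n \<omega> - S k n \<omega>) = measure_pmf p"
    and S_indep_past:
      "\<And>n. indep_set (generated_events (space M) (\<lambda>k. S k n) UNIV)
                      (generated_events (space M) (\<lambda>(m, i). C m i) ({..n} \<times> {1..}))"
    and C_Suc: "\<And>n j \<omega>. j \<ge> 1 \<Longrightarrow> \<omega> \<in> space M \<Longrightarrow>
      C (Suc n) j \<omega> = (\<Sum>i = 1 + S (j - 1) n \<omega>..S j n \<omega>. C n i \<omega>)"

definition mass_function :: "'a measure \<Rightarrow> ('a \<Rightarrow> nat) \<Rightarrow> nat \<Rightarrow> real" where
  "mass_function M Y j = measure M {\<omega> \<in> space M. Y \<omega> = j}"

definition critical :: "nat pmf \<Rightarrow> bool" where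
  "critical p \<longleftrightarrow> ((\<lambda>k. real k * pmf p k) has_sum 1) UNIV"

definition delta :: "nat \<Rightarrow> nat \<Rightarrow> real" where
  "delta j k = (if k = j then 1 else 0)"

definition rho :: "(nat \<Rightarrow> real) \<Rightarrow> real" where
  "rho \<nu> = (\<Sum>\<^sub>\<infinity>j\<in>{1..}. \<nu> j)"

definition R_hat :: "nat pmf \<Rightarrow> nat \<Rightarrow> real \<Rightarrow> real" where
  "R_hat p k r = (\<Sum>\<^sub>\<infinity>l\<in>{k..}. pmf p l * real (l choose k) * r ^ k * (1 - r) ^ (l - k))"

definition I_hat :: "nat \<Rightarrow> (nat \<Rightarrow> real) \<Rightarrow> nat \<Rightarrow> real" where
  "I_hat k \<nu> j = (\<Sum>\<^sub>\<infinity>i\<in>{1..k} \<rightarrow>\<^sub>E {1..}.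
     (delta j (\<Sum>l=1..k. i l) - (\<Sum>l=1..k. delta j (i l))) * (\<Prod>l=1..k. \<nu> (i l) / rho \<nu>))"

end

theory Submission
  imports Defs
begin

text \<open>
  Write \<open>compound p q\<close> for the law of a sum of a \<open>p\<close>-distributed number of
  independent \<open>q\<close>-distributed terms. Conditioning a Galton-Watson process on its last generation
  shows that the law of \<open>X (Suc n)\<close> is the law of \<open>X n\<close> compounded with \<open>p\<close>; one step of the
  coagulation process merges a \<open>p\<close>-distributed number of independent clusters, so that the law of a
  cluster at time \<open>Suc n\<close> is \<open>p\<close> compounded with the law of a cluster at time \<open>n\<close>. Compounding is
  associative (\<open>compound_assoc\<close>), as composition of generating functions is, and both processes
  start at one; hence both laws are the \<open>n\<close>-fold iterate of \<open>p\<close> (\<open>distr_X\<close>, \<open>distr_C\<close>). For the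
  coagulation process the induction must also carry along that the clusters are independent, which
  is done through the joint laws of initial segments (\<open>distr_C_list\<close>).

  For the evolution equation, let \<open>q\<close> be the law at time \<open>n\<close>, of which \<open>\<rho>\<close> is the mass on the positive
  integers. A \<open>q\<close>-distributed variable is nonzero with probability \<open>\<rho>\<close> and then has the conditional
  law \<open>t\<close>, that is, \<open>q\<close> is a Bernoulli law compounded with \<open>t\<close>. By associativity,
  \<open>compound p q = compound R t\<close>, where \<open>R\<close> is \<open>p\<close> compounded with the Bernoulli law. The point
  probabilities of \<open>R\<close> are the rates \<open>R_hat\<close> (\<open>R_hat_eq_pmf\<close>), and \<open>I_hat\<close> is the mass at \<open>j\<close> of the
  \<open>k\<close>-fold convolution of \<open>t\<close> minus \<open>k\<close> times the mass of \<open>t\<close> at \<open>j\<close> (\<open>I_hat_eq\<close>). Summed against \<open>R\<close>,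
  the first part gives the law at time \<open>Suc n\<close>, and the second one gives the mean of \<open>R\<close> times the
  mass of \<open>t\<close> at \<open>j\<close>. Criticality enters here: by Wald's identity \<open>R\<close> has mean \<open>\<rho>\<close>, and the product
  is the mass of \<open>q\<close> at \<open>j\<close> (\<open>coagulation_equation\<close>).
\<close>

section \<open>Convolution powers and compound laws\<close>

primrec conv_power :: "nat pmf \<Rightarrow> nat \<Rightarrow> nat pmf" where
  "conv_power q 0 = return_pmf 0"
| "conv_power q (Suc n) = bind_pmf q (\<lambda>x. map_pmf ((+) x) (conv_power q n))"

text \<open>The law of a random sum. Its generating function is the one of \<open>p\<close> composed with the
  one of \<open>q\<close>.\<close>

definition compound :: "nat pmf \<Rightarrow> nat pmf \<Rightarrow> nat pmf" where
  "compound p q = bind_pmf p (conv_power q)"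

lemma conv_power_add:
  "conv_power q (m + n) = bind_pmf (conv_power q m) (\<lambda>x. map_pmf ((+) x) (conv_power q n))"
  by (induction m)
     (simp_all add: bind_return_pmf bind_assoc_pmf map_pmf_def bind_return_pmf' add.assoc)

text \<open>Independence allows \<open>m\<close> groups, of \<open>p\<close>-distributed sizes, to be merged into one
  sum whose number of terms is the total size: the commutation step draws all sizes before any of
  the terms.\<close>

lemma conv_power_compound: "conv_power (compound p q) m = bind_pmf (conv_power p m) (conv_power q)"
proof (induction m)
  case (Suc m)
  have "conv_power (compound p q) (Suc m) =
      bind_pmf p (\<lambda>k. bind_pmf (conv_power q k)
        (\<lambda>x. bind_pmf (conv_power p m) (\<lambda>l. map_pmf ((+) x) (conv_power q l))))"
    by (simp add: Suc) (simp add: compound_def map_pmf_def bind_assoc_pmf)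
  also have "\<dots> = bind_pmf p (\<lambda>k. bind_pmf (conv_power p m) (\<lambda>l. conv_power q (k + l)))"
    by (subst bind_commute_pmf) (simp add: conv_power_add)
  also have "\<dots> = bind_pmf (conv_power p (Suc m)) (conv_power q)"
    by (simp add: bind_assoc_pmf map_pmf_def bind_return_pmf)
  finally show ?case .
qed (simp add: bind_return_pmf)

text \<open>The counterpart of associativity for composition of generating functions. It is what
  makes the two processes agree, and it is used once more to rewrite a step of the process as a sum
  over nonzero clusters only.\<close>

lemma compound_assoc: "compound (compound p q) r = compound p (compound q r)"
proof -
  have "compound p (compound q r) = bind_pmf p (\<lambda>m. conv_power (compound q r) m)"
    by (simp add: compound_def[of p])
  also have "\<dots> = compound (compound p q) r"
    unfolding conv_power_compound by (simp add: compound_def bind_assoc_pmf)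
  finally show ?thesis by simp
qed

lemma conv_power_return_1 [simp]: "conv_power (return_pmf (Suc 0)) n = return_pmf n"
  by (induction n) (simp_all add: bind_return_pmf)

lemma compound_return_1 [simp]:
  "compound (return_pmf (Suc 0)) p = p" "compound p (return_pmf (Suc 0)) = p"
  by (simp_all add: compound_def bind_return_pmf bind_return_pmf' map_pmf_def cong: bind_pmf_cong)

primrec iterate_law :: "nat pmf \<Rightarrow> nat \<Rightarrow> nat pmf" where
  "iterate_law p 0 = return_pmf 1"
| "iterate_law p (Suc n) = compound p (iterate_law p n)"

text \<open>The coagulation process produces its laws by composing with \<open>p\<close> on the left, as in
  the definition of \<open>iterate_law\<close>, the Galton-Watson process by composing on the right.\<close>

lemma iterate_law_Suc_right: "iterate_law p (Suc n) = compound (iterate_law p n) p"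
proof (induction n)
  case (Suc n)
  have "iterate_law p (Suc (Suc n)) = compound p (compound (iterate_law p n) p)"
    using Suc by simp
  also have "\<dots> = compound (iterate_law p (Suc n)) p"
    by (simp add: compound_assoc)
  finally show ?case .
qed simp

text \<open>The recursion above suits the algebra; independent samples from a process come as
  lists.\<close>

lemma conv_power_replicate: "conv_power q n = map_pmf sum_list (replicate_pmf n q)"
  by (induction n)
     (simp_all add: map_pmf_def bind_assoc_pmf bind_return_pmf)

section \<open>Means\<close>

lemma nn_mean_conv_power:
  "(\<integral>\<^sup>+x. of_nat x \<partial>conv_power q n) = of_nat n * (\<integral>\<^sup>+x. of_nat x \<partial>q)"
proof (induction n)
  case (Suc n)
  have "(\<integral>\<^sup>+x. of_nat x \<partial>conv_power q (Suc n))
      = (\<integral>\<^sup>+x. (\<integral>\<^sup>+y. of_nat x + of_nat y \<partial>conv_power q n) \<partial>q)"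
    by simp
  also have "\<dots> = (\<integral>\<^sup>+x. of_nat x \<partial>q) + (\<integral>\<^sup>+y. of_nat y \<partial>conv_power q n)"
    by (simp add: nn_integral_add del: of_nat_add)
  finally show ?case by (simp add: Suc algebra_simps)
qed simp

text \<open>Wald's identity. Stated in the extended nonnegative reals, it needs no case
  distinction on finiteness of the means.\<close>

lemma nn_mean_compound:
  "(\<integral>\<^sup>+x. of_nat x \<partial>compound p q) = (\<integral>\<^sup>+x. of_nat x \<partial>p) * (\<integral>\<^sup>+x. of_nat x \<partial>q)"
  by (simp add: compound_def nn_mean_conv_power nn_integral_multc)

lemma nn_mean_iterate_law:
  "(\<integral>\<^sup>+x. of_nat x \<partial>measure_pmf p) = 1 \<Longrightarrow> (\<integral>\<^sup>+x. of_nat x \<partial>iterate_law p n) = 1"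
  by (induction n) (simp_all add: nn_mean_compound)

lemma nn_mean_critical:
  assumes "critical p" shows "(\<integral>\<^sup>+x. of_nat x \<partial>measure_pmf p) = (1::ennreal)"
proof -
  have s: "(\<lambda>k. real k * pmf p k) sums 1"
    using assms unfolding critical_def by (rule has_sum_imp_sums)
  have "(\<integral>\<^sup>+x. of_nat x \<partial>measure_pmf p) = (\<Sum>k. ennreal (real k * pmf p k))"
    by (simp add: nn_integral_measure_pmf nn_integral_count_space_nat ennreal_mult
          ennreal_of_nat_eq_real_of_nat mult.commute)
  also have "\<dots> = ennreal (\<Sum>k. real k * pmf p k)"
    using s by (intro suminf_ennreal2) (auto simp: sums_iff)
  finally show ?thesis using s by (simp add: sums_iff)
qed

section \<open>Thinning and the coagulation rates\<close>

lemma has_sum_expectation: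
  fixes f :: "'a \<Rightarrow> real"
  assumes "integrable (measure_pmf p) f"
  shows "((\<lambda>x. pmf p x * f x) has_sum measure_pmf.expectation p f) UNIV"
proof -
  have "integrable (count_space UNIV) (\<lambda>x. pmf p x * f x)"
    using assms by (simp add: measure_pmf_eq_density integrable_density)
  hence *: "Infinite_Set_Sum.abs_summable_on (\<lambda>x. pmf p x * f x) UNIV"
    by (simp add: abs_summable_on_def)
  hence "(\<lambda>x. pmf p x * f x) summable_on UNIV"
    by (metis abs_summable_equivalent abs_summable_summable)
  thus ?thesis
    by (simp add: pmf_expectation_eq_infsetsum infsetsum_infsum[OF *])
qed

lemma has_sum_pmf_bind:
  "((\<lambda>x. pmf p x * pmf (f x) i) has_sum pmf (bind_pmf p f) i) UNIV"
  unfolding pmf_bind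
  by (intro has_sum_expectation measure_pmf.integrable_const_bound[where B=1])
     (auto simp: pmf_le_1)

text \<open>Compounding with this law on \<open>{0, 1}\<close> is independent thinning: each of the counted
  items is kept with probability \<open>r\<close>.\<close>

definition bernoulli_nat :: "real \<Rightarrow> nat pmf" where
  "bernoulli_nat r = map_pmf of_bool (bernoulli_pmf r)"

lemma conv_power_bernoulli_nat:
  assumes "r \<in> {0..1}"
  shows "conv_power (bernoulli_nat r) n = binomial_pmf n r"
proof (induction n)
  case (Suc n)
  show ?case using assms
    by (auto simp: binomial_pmf_Suc Suc[symmetric] bernoulli_nat_def map_pmf_def bind_assoc_pmf
       bind_return_pmf intro!: bind_pmf_cong)
qed (use assms in \<open>simp add: binomial_pmf_0\<close>)

text \<open>Among \<open>l\<close> merging clusters the number of nonzero ones is binomial, so \<open>R_hat\<close> is the law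
  of the number of nonzero clusters in a merger.\<close>

lemma R_hat_eq_pmf:
  assumes "r \<in> {0..1}"
  shows "R_hat p k r = pmf (compound p (bernoulli_nat r)) k"
proof -
  have "((\<lambda>l. pmf p l * pmf (binomial_pmf l r) k) has_sum pmf (compound p (bernoulli_nat r)) k) UNIV"
    using has_sum_pmf_bind[of p "conv_power (bernoulli_nat r)" k] assms
    by (simp add: compound_def conv_power_bernoulli_nat)
  hence "infsum (\<lambda>l. pmf p l * pmf (binomial_pmf l r) k) UNIV = pmf (compound p (bernoulli_nat r)) k"
    by (rule infsumI)
  moreover have "R_hat p k r = infsum (\<lambda>l. pmf p l * pmf (binomial_pmf l r) k) UNIV"
    unfolding R_hat_def using assms by (intro infsum_cong_neutral) (auto simp: mult.assoc)
  ultimately show ?thesis by simp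
qed

lemma nn_mean_bernoulli_nat:
  assumes "r \<in> {0..1}"
  shows "(\<integral>\<^sup>+x. of_nat x \<partial>bernoulli_nat r) = ennreal r"
  using assms by (simp add: bernoulli_nat_def)

text \<open>A \<open>q\<close>-distributed variable is obtained by first deciding whether it is nonzero and
  then, if it is, drawing its value from the conditional law.\<close>

lemma compound_bernoulli_nat_cond_pmf:
  assumes ne: "set_pmf q \<inter> {1..} \<noteq> {}"
  shows "compound (bernoulli_nat (measure q {1..})) (cond_pmf q {1..}) = q"
proof (rule pmf_eqI)
  fix i
  have pos: "measure q {1..} > 0"
    using measure_measure_pmf_not_zero[OF ne] by (simp add: less_le)
  have "measure q {1..} = 1 - measure q {0}"
    by (subst measure_pmf.prob_compl[symmetric]) (auto intro!: arg_cong[where f="measure q"])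
  hence z: "pmf q 0 = 1 - measure q {1..}" by (simp add: measure_pmf_single)
  have "compound (bernoulli_nat (measure q {1..})) (cond_pmf q {1..})
    = bind_pmf (bernoulli_pmf (measure q {1..})) (\<lambda>b. if b then cond_pmf q {1..} else return_pmf 0)"
    unfolding compound_def bernoulli_nat_def
    by (auto simp: map_pmf_def bind_assoc_pmf bind_return_pmf bind_return_pmf' intro!: bind_pmf_cong)
  thus "pmf (compound (bernoulli_nat (measure q {1..})) (cond_pmf q {1..})) i = pmf q i"
    using pos z by (cases "i = 0") (auto simp: pmf_bind pmf_cond[OF ne] indicator_def simp del: One_nat_def)
qed

lemma rho_pmf: "rho (pmf q) = measure q {1..}"
  by (simp add: rho_def measure_pmf_conv_infsetsum infsetsum_infsum pmf_abs_summable)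

lemma map_sum_Pi_pmf:
  "finite A \<Longrightarrow> map_pmf (\<lambda>f. \<Sum>x\<in>A. f x) (Pi_pmf A d (\<lambda>_. q)) = conv_power q (card A)"
proof (induction A rule: finite_induct)
  case (insert a A)
  have [simp]: "(\<Sum>x\<in>A. if x = a then y else f x) = (\<Sum>x\<in>A. f x)" for f :: "'a \<Rightarrow> nat" and y
    using insert by (intro sum.cong) auto
  show ?case using insert
    by (simp add: Pi_pmf_insert' map_pmf_def bind_assoc_pmf bind_return_pmf flip: insert.IH)
qed simp

text \<open>The weights in \<open>I_hat\<close> are those of \<open>k\<close> independent variables with the law of a
  nonzero cluster. The sum is therefore the expectation of a bounded function of them: the
  probability that they add up to \<open>j\<close> minus the expected number of them that equal \<open>j\<close>.\<close>

lemma I_hat_eq: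
  assumes ne: "set_pmf q \<inter> {1..} \<noteq> {}"
  defines "r \<equiv> cond_pmf q {1..}"
  shows "I_hat k (pmf q) j = pmf (conv_power r k) j - real k * pmf r j"
proof -
  \<comment> \<open>The default value \<open>undefined\<close> makes the support consist of extensional functions.\<close>
  let ?P = "Pi_pmf {1..k} undefined (\<lambda>_. r)"
  let ?h = "\<lambda>i. delta j (\<Sum>l=1..k. i l) - (\<Sum>l=1..k. delta j (i l))"
  have d: "delta j = indicator {j}"
    by (auto simp: delta_def fun_eq_iff indicator_def)
  have int: "integrable ?P (\<lambda>i. delta j (g i))" for g
    by (intro measure_pmf.integrable_const_bound[where B=1]) (auto simp: delta_def)
  have E: "measure_pmf.expectation ?P (\<lambda>i. delta j (g i)) = pmf (map_pmf g ?P) j" for g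
    by (simp add: d pmf_map indicator_vimage[symmetric] comp_def[symmetric] del: indicator_simps)
  have "((\<lambda>i. pmf ?P i * ?h i) has_sum measure_pmf.expectation ?P ?h) UNIV"
    by (intro has_sum_expectation Bochner_Integration.integrable_diff
        Bochner_Integration.integrable_sum int)
  moreover have "measure_pmf.expectation ?P ?h = pmf (conv_power r k) j - real k * pmf r j"
    by (simp add: Bochner_Integration.integral_diff Bochner_Integration.integral_sum
        int E map_sum_Pi_pmf Pi_pmf_component del: One_nat_def)
  moreover have "infsum (\<lambda>i. pmf ?P i * ?h i) UNIV = I_hat k (pmf q) j"
    unfolding I_hat_def
  proof (rule infsum_cong_neutral, goal_cases)
    case (2 i)
    hence "i \<notin> set_pmf ?P"
      by (auto simp: set_Pi_pmf PiE_dflt_def r_def ne PiE_iff extensional_def simp del: One_nat_def)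
    thus ?case by (simp add: set_pmf_iff)
  next
    case (3 i)
    hence "pmf ?P i = (\<Prod>l=1..k. pmf q (i l) / rho (pmf q))"
      by (auto simp: pmf_Pi r_def pmf_cond[OF ne] rho_pmf PiE_iff extensional_def simp del: One_nat_def intro!: prod.cong)
    thus ?case by simp
  qed auto
  ultimately show ?thesis by (simp add: infsumI)
qed

text \<open>Let \<open>t\<close> be the law of a nonzero cluster and \<open>R\<close> the law of the number of nonzero
  clusters in a merger. By thinning and associativity, \<open>compound p q = compound R t\<close>, which gives
  the gain terms of the right-hand side. The loss terms add up to the mean of \<open>R\<close> times
  \<open>pmf t j\<close>; as \<open>p\<close> has mean one, the mean of \<open>R\<close> is \<open>rho (pmf q)\<close>, and this product is \<open>pmf q j\<close>.
  That \<open>q\<close> has a nonzero mean ensures that \<open>t\<close> is a conditional law on an event of positive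
  probability.\<close>

lemma coagulation_equation:
  assumes mean: "(\<integral>\<^sup>+x. of_nat x \<partial>measure_pmf p) = (1::ennreal)"
    and mq: "(\<integral>\<^sup>+x. of_nat x \<partial>measure_pmf q) \<noteq> (0::ennreal)" and j: "j > 0"
  shows "((\<lambda>k. R_hat p k (rho (pmf q)) * I_hat k (pmf q) j)
     has_sum (pmf (compound p q) j - pmf q j)) {2..}"
proof -
  have ne: "set_pmf q \<inter> {1..} \<noteq> {}"
  proof
    assume "set_pmf q \<inter> {1..} = {}"
    hence "AE x in measure_pmf q. x = 0"
      by (auto simp: AE_measure_pmf_iff Suc_le_eq disjoint_iff)
    hence "(\<integral>\<^sup>+x. of_nat x \<partial>measure_pmf q) = (\<integral>\<^sup>+x. (0::ennreal) \<partial>measure_pmf q)"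
      by (intro nn_integral_cong_AE) auto
    with mq show False by simp
  qed
  define r where "r = rho (pmf q)"
  define t where "t = cond_pmf q {1..}"
  have rho: "r = measure q {1..}"
    by (simp add: r_def rho_pmf)
  hence r01: "r \<in> {0..1}" by simp
  have rpos: "r > 0" using measure_measure_pmf_not_zero[OF ne] rho by (simp add: less_le)
  have thin: "compound (bernoulli_nat r) t = q"
    unfolding rho t_def by (rule compound_bernoulli_nat_cond_pmf[OF ne])
  define R where "R = compound p (bernoulli_nat r)"
  have "(\<integral>\<^sup>+k. ennreal (real k) \<partial>R) = ennreal r"
    using nn_mean_compound[of p "bernoulli_nat r"] r01
    by (simp add: R_def mean nn_mean_bernoulli_nat flip: ennreal_of_nat_eq_real_of_nat)
  hence intR: "integrable R real" and ER: "measure_pmf.expectation R real = r"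
    using r01 by (auto intro!: integrableI_nn_integral_finite simp: integral_eq_nn_integral)
  let ?f = "\<lambda>k. pmf (conv_power t k) j - real k * pmf t j"
  have i1: "integrable R (\<lambda>k. pmf (conv_power t k) j)"
    by (intro measure_pmf.integrable_const_bound[where B=1]) (auto simp: pmf_le_1)
  have i2: "integrable R (\<lambda>k. real k * pmf t j)"
    using intR by simp
  have "measure_pmf.expectation R ?f = pmf (compound R t) j - r * pmf t j"
    by (simp add: Bochner_Integration.integral_diff[OF i1 i2] ER compound_def pmf_bind)
  also have "compound R t = compound p q"
    by (simp add: R_def compound_assoc thin)
  also have "r * pmf t j = pmf q j"
    using rpos j by (simp add: t_def pmf_cond[OF ne] rho del: One_nat_def)
  finally have "((\<lambda>k. pmf R k * ?f k) has_sum (pmf (compound p q) j - pmf q j)) UNIV"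
    using has_sum_expectation[OF Bochner_Integration.integrable_diff[OF i1 i2]] by simp
  \<comment> \<open>No nonzero cluster contributes nothing as \<open>j > 0\<close>; a single one stays unchanged.\<close>
  moreover have "?f k = 0" if "k < 2" for k
    using that j by (cases k) (auto simp: less_Suc_eq numeral_2_eq_2 map_pmf_def bind_return_pmf bind_return_pmf')
  ultimately have "((\<lambda>k. pmf R k * ?f k) has_sum (pmf (compound p q) j - pmf q j)) {2..}"
    by (subst has_sum_cong_neutral[where T=UNIV and g="\<lambda>k. pmf R k * ?f k"]) auto
  thus ?thesis
    using r01 by (simp add: R_hat_eq_pmf I_hat_eq[OF ne] R_def t_def flip: r_def)
qed

section \<open>Laws of independent samples and random indices\<close>

lemma measurable_map_list:
  fixes Y :: "'i \<Rightarrow> 'a \<Rightarrow> nat"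
  assumes "\<And>i. i \<in> set xs \<Longrightarrow> Y i \<in> measurable F (count_space UNIV)"
  shows "(\<lambda>\<omega>. map (\<lambda>i. Y i \<omega>) xs) \<in> measurable F (count_space UNIV)"
  using assms
proof (induction xs)
  case (Cons x xs)
  have "(\<lambda>\<omega>. Y x \<omega> # map (\<lambda>i. Y i \<omega>) xs) \<in> measurable F (count_space UNIV)"
  proof (rule measurable_compose_countable[where g="Y x" and f="\<lambda>v \<omega>. v # map (\<lambda>i. Y i \<omega>) xs"])
    fix v
    show "(\<lambda>\<omega>. v # map (\<lambda>i. Y i \<omega>) xs) \<in> measurable F (count_space UNIV)"
      using measurable_compose[OF Cons.IH measurable_count_space, of "(#) v"] Cons.prems by simp
  qed (use Cons.prems in auto)
  thus ?case by simp
qed simp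

context prob_space
begin

text \<open>The law of total probability for a family of variables evaluated at an independent
  countable-valued random index. Both conditioning steps below use it: on the last generation of the
  Galton-Watson process and on the merger sizes of the coagulation process.\<close>

lemma distr_random_choice:
  fixes T :: "'a \<Rightarrow> 'i::countable" and Z :: "'i \<Rightarrow> 'a \<Rightarrow> 'c::countable"
  assumes T: "random_variable (count_space UNIV) T"
    and Z: "\<And>i. random_variable (count_space UNIV) (Z i)"
    and law_T: "distr M (count_space UNIV) T = measure_pmf q"
    and law_Z: "\<And>i. distr M (count_space UNIV) (Z i) = measure_pmf (\<kappa> i)"
    and indep: "\<And>i B. prob ((T -` {i} \<inter> space M) \<inter> (Z i -` B \<inter> space M)) =
        prob (T -` {i} \<inter> space M) * prob (Z i -` B \<inter> space M)"
  shows "distr M (count_space UNIV) (\<lambda>\<omega>. Z (T \<omega>) \<omega>) = measure_pmf (bind_pmf q \<kappa>)"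
proof (rule measure_eqI)
  fix A
  let ?E = "\<lambda>i. (T -` {i} \<inter> space M) \<inter> (Z i -` A \<inter> space M)"
  have ZT: "random_variable (count_space UNIV) (\<lambda>\<omega>. Z (T \<omega>) \<omega>)"
    by (rule measurable_compose_countable[OF Z T])
  have E: "?E i \<in> events" for i
    using T Z by (intro sets.Int measurable_sets) auto
  have "emeasure (distr M (count_space UNIV) (\<lambda>\<omega>. Z (T \<omega>) \<omega>)) A = emeasure M (\<Union>i\<in>UNIV. ?E i)"
    by (subst emeasure_distr[OF ZT]) (auto intro!: arg_cong[where f="emeasure M"])
  also have "\<dots> = (\<integral>\<^sup>+i. emeasure M (?E i) \<partial>count_space UNIV)"
    by (rule emeasure_UN_countable) (use E in \<open>auto simp: disjoint_family_on_def\<close>)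
  also have "\<dots> = (\<integral>\<^sup>+i. ennreal (pmf q i) * emeasure (\<kappa> i) A \<partial>count_space UNIV)"
  proof (rule nn_integral_cong)
    fix i
    have "pmf q i = prob (T -` {i} \<inter> space M)"
      using T by (simp add: pmf.rep_eq measure_distr flip: law_T)
    moreover have "emeasure (\<kappa> i) A = prob (Z i -` A \<inter> space M)"
      using Z by (simp add: emeasure_distr emeasure_eq_measure flip: law_Z)
    ultimately show "emeasure M (?E i) = ennreal (pmf q i) * emeasure (\<kappa> i) A"
      by (simp add: emeasure_eq_measure indep ennreal_mult)
  qed
  also have "\<dots> = emeasure (bind_pmf q \<kappa>) A"
    by (simp add: nn_integral_measure_pmf)
  finally show "emeasure (distr M (count_space UNIV) (\<lambda>\<omega>. Z (T \<omega>) \<omega>)) A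
      = emeasure (bind_pmf q \<kappa>) A" .
qed simp

lemma distr_compose_pmf:
  assumes "random_variable (count_space UNIV) Y"
    and "distr M (count_space UNIV) Y = measure_pmf q"
  shows "distr M (count_space UNIV) (\<lambda>\<omega>. f (Y \<omega>)) = measure_pmf (map_pmf f q)"
  using assms by (simp add: map_pmf_rep_eq distr_distr comp_def flip: assms(2))

text \<open>Functions of disjoint blocks of an independent family are independent. The
  conclusion is about events since \<open>indep_var\<close> would force both functions into one value type.\<close>

lemma prob_disjoint_blocks:
  assumes ind: "indep_vars (\<lambda>_. count_space UNIV) Y I"
    and AB: "A \<inter> B = {}" "A \<subseteq> I" "B \<subseteq> I"
    and f: "f \<in> measurable (PiM A (\<lambda>_. count_space UNIV)) (count_space UNIV)"
    and g: "g \<in> measurable (PiM B (\<lambda>_. count_space UNIV)) (count_space UNIV)"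
    and F: "\<And>\<omega>. \<omega> \<in> space M \<Longrightarrow> F \<omega> = f (restrict (\<lambda>i. Y i \<omega>) A)"
    and G: "\<And>\<omega>. \<omega> \<in> space M \<Longrightarrow> G \<omega> = g (restrict (\<lambda>i. Y i \<omega>) B)"
  shows "prob ((F -` U \<inter> space M) \<inter> (G -` V \<inter> space M)) =
         prob (F -` U \<inter> space M) * prob (G -` V \<inter> space M)"
proof -
  let ?PA = "PiM A (\<lambda>_. count_space UNIV)" and ?PB = "PiM B (\<lambda>_. count_space UNIV)"
  let ?YA = "\<lambda>\<omega>. restrict (\<lambda>i. Y i \<omega>) A" and ?YB = "\<lambda>\<omega>. restrict (\<lambda>i. Y i \<omega>) B"
  let ?U = "f -` U \<inter> space ?PA" and ?V = "g -` V \<inter> space ?PB"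
  have "prob ((\<lambda>\<omega>. (?YA \<omega>, ?YB \<omega>)) -` (?U \<times> ?V) \<inter> space M) =
      prob (?YA -` ?U \<inter> space M) * prob (?YB -` ?V \<inter> space M)"
    by (rule indep_varD[OF indep_var_restrict[OF ind AB]])
       (use measurable_sets[OF f, of U] measurable_sets[OF g, of V] in auto)
  moreover have "?YA -` ?U \<inter> space M = F -` U \<inter> space M" "?YB -` ?V \<inter> space M = G -` V \<inter> space M"
    by (auto simp: F G space_PiM)
  moreover have "(\<lambda>\<omega>. (?YA \<omega>, ?YB \<omega>)) -` (?U \<times> ?V) \<inter> space M
      = (?YA -` ?U \<inter> space M) \<inter> (?YB -` ?V \<inter> space M)"
    by auto
  ultimately show ?thesis by simp
qed

text \<open>By induction on the list: the head plays the role of the random index and the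
  remaining entries form the family, which are independent as they use different variables.\<close>

lemma distr_iid_list:
  fixes Y :: "'i \<Rightarrow> 'a \<Rightarrow> nat"
  assumes ind: "indep_vars (\<lambda>_. count_space UNIV) Y I"
    and law: "\<And>i. i \<in> I \<Longrightarrow> distr M (count_space UNIV) (Y i) = measure_pmf q"
    and xs: "distinct xs" "set xs \<subseteq> I"
  shows "distr M (count_space UNIV) (\<lambda>\<omega>. map (\<lambda>i. Y i \<omega>) xs) = measure_pmf (replicate_pmf (length xs) q)"
  using xs
proof (induction xs)
  case Nil
  show ?case by (simp add: return_pmf.rep_eq)
next
  case (Cons x xs)
  let ?L = "\<lambda>\<omega>. map (\<lambda>i. Y i \<omega>) xs"
  have meas: "random_variable (count_space UNIV) (Y i)" if "i \<in> I" for i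
    using ind that by (auto simp: indep_vars_def)
  have L: "random_variable (count_space UNIV) ?L"
    by (rule measurable_map_list) (use Cons.prems meas in auto)
  have "distr M (count_space UNIV) (\<lambda>\<omega>. Y x \<omega> # ?L \<omega>)
     = measure_pmf (bind_pmf q (\<lambda>v. map_pmf ((#) v) (replicate_pmf (length xs) q)))"
  proof (rule distr_random_choice[where T="Y x" and Z="\<lambda>v \<omega>. v # ?L \<omega>"])
    show "random_variable (count_space UNIV) (\<lambda>\<omega>. v # ?L \<omega>)" for v
      using measurable_compose[OF L measurable_count_space, of "(#) v"] by simp
    show "distr M (count_space UNIV) (\<lambda>\<omega>. v # ?L \<omega>) =
        measure_pmf (map_pmf ((#) v) (replicate_pmf (length xs) q))" for v
      using Cons by (intro distr_compose_pmf L) auto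
    show "prob ((Y x -` {v} \<inter> space M) \<inter> ((\<lambda>\<omega>. v # ?L \<omega>) -` B \<inter> space M)) =
        prob (Y x -` {v} \<inter> space M) * prob ((\<lambda>\<omega>. v # ?L \<omega>) -` B \<inter> space M)" for v B
    proof -
      have "(\<lambda>f. v # map f xs) \<in> measurable (PiM (set xs) (\<lambda>_. count_space UNIV)) (count_space UNIV)"
        by (rule measurable_compose[OF measurable_map_list])
           (auto intro!: measurable_component_singleton)
      with Cons.prems show ?thesis
        by (intro prob_disjoint_blocks[OF ind, of "{x}" "set xs" "\<lambda>f. f x" "\<lambda>f. v # map f xs"])
           (auto intro!: measurable_component_singleton)
    qed
  qed (use Cons.prems meas law in auto)
  thus ?case by (simp add: map_pmf_def)
qed

end

section \<open>The law of the Galton-Watson process\<close>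

text \<open>The population size as an explicit function of the offspring numbers, with \<open>f (k, n)\<close>
  the number of children of the \<open>k\<close>-th member of generation \<open>n - 1\<close>. It makes visible that
  generation \<open>n\<close> is determined by the offspring numbers with second index in \<open>{1..n}\<close> and is hence
  independent of those with second index \<open>Suc n\<close>.\<close>

primrec gw_path :: "nat \<Rightarrow> (nat \<times> nat \<Rightarrow> nat) \<Rightarrow> nat" where
  "gw_path 0 f = 1"
| "gw_path (Suc n) f = sum_list (map (\<lambda>k. f (k, Suc n)) [1..<Suc (gw_path n f)])"

lemma gw_path_cong:
  "(\<And>x. x \<in> {1..} \<times> {1..n} \<Longrightarrow> f x = g x) \<Longrightarrow> gw_path n f = gw_path n g"
proof (induction n)
  case (Suc n)
  have "gw_path n f = gw_path n g" using Suc by auto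
  thus ?case using Suc.prems by (auto intro!: arg_cong[where f=sum_list] simp del: upt_Suc)
qed simp

lemma measurable_gw_path:
  "m \<le> n \<Longrightarrow> gw_path m \<in> measurable (PiM ({1..} \<times> {1..n}) (\<lambda>_. count_space UNIV)) (count_space UNIV)"
proof (induction m)
  case (Suc m)
  let ?P = "PiM ({1..} \<times> {1..n}) (\<lambda>_. count_space (UNIV :: nat set))"
  have "(\<lambda>f. sum_list (map (\<lambda>k. f (k, Suc m)) [1..<Suc (gw_path m f)])) \<in> measurable ?P (count_space UNIV)"
  proof (rule measurable_compose_countable[where g="gw_path m" and
        f="\<lambda>i f. sum_list (map (\<lambda>k. f (k, Suc m)) [1..<Suc i])"])
    fix i
    have L: "(\<lambda>f. map (\<lambda>k. f (k, Suc m)) [1..<Suc i]) \<in> measurable ?P (count_space (UNIV :: nat list set))"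
      by (rule measurable_map_list[where Y="\<lambda>k f. f (k, Suc m)"],
          rule measurable_component_singleton) (use Suc.prems in auto)
    show "(\<lambda>f. sum_list (map (\<lambda>k. f (k, Suc m)) [1..<Suc i])) \<in> measurable ?P (count_space UNIV)"
      by (rule measurable_compose[OF L, where g=sum_list]) simp
  qed (use Suc in auto)
  thus ?case by simp
next
  case 0
  have "gw_path 0 = (\<lambda>_. 1)" by auto
  thus ?case by simp
qed

context galton_watson
begin

lemma X_eq_gw_path: "\<omega> \<in> space M \<Longrightarrow> X n \<omega> = gw_path n (\<lambda>(k, n). \<xi> k n \<omega>)"
proof (induction n)
  case (Suc n)
  thus ?case
    by (simp add: X_Suc interv_sum_list_conv_sum_set_nat atLeastLessThanSuc_atLeastAtMost del: upt_Suc)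
qed (simp add: X_0)

text \<open>Given \<open>X n = m\<close>, the next generation is a sum of \<open>m\<close> offspring numbers that are
  independent of \<open>X n\<close>. Measurability of \<open>X n\<close>, which conditioning on it needs, is proved in the
  same induction.\<close>

lemma distr_X: "random_variable (count_space UNIV) (X n) \<and>
  distr M (count_space UNIV) (X n) = measure_pmf (iterate_law p n)"
proof (induction n)
  case 0
  have "distr M (count_space UNIV) (X 0) = distr M (count_space UNIV) (\<lambda>_. 1)"
    by (intro distr_cong) (auto simp: X_0)
  moreover have "random_variable (count_space UNIV) (X 0)"
    by (subst measurable_cong[where g="\<lambda>_. 1"]) (auto simp: X_0)
  ultimately show ?case by (simp add: return_pmf.rep_eq)
next
  case (Suc n)
  let ?Y = "\<lambda>(k, n). \<xi> k n"
  let ?A = "{1..} \<times> {1..n}" and ?B = "{1..} \<times> {Suc n}"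
  let ?L = "\<lambda>m \<omega>. map (\<lambda>k. \<xi> k (Suc n) \<omega>) [1..<Suc m]"
  have meas: "random_variable (count_space UNIV) (\<xi> k m)" if "k \<ge> 1" "m \<ge> 1" for k m
    using offspring_indep that by (auto simp: indep_vars_def)
  have mL: "random_variable (count_space UNIV) (?L m)" for m
    by (rule measurable_map_list) (auto intro!: meas)
  have lawL: "distr M (count_space UNIV) (?L m) = measure_pmf (replicate_pmf m p)" for m
  proof -
    have "distr M (count_space UNIV) (\<lambda>\<omega>. map (\<lambda>i. ?Y i \<omega>) (map (\<lambda>k. (k, Suc n)) [1..<Suc m]))
        = measure_pmf (replicate_pmf (length (map (\<lambda>k. (k, Suc n)) [1..<Suc m])) p)"
      by (rule distr_iid_list[OF offspring_indep])
         (auto simp: offspring_law distinct_map inj_on_def simp del: upt_Suc)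
    thus ?thesis by (simp add: comp_def del: upt_Suc)
  qed
  have ind: "prob ((X n -` {m} \<inter> space M) \<inter> (?L m -` V \<inter> space M)) =
      prob (X n -` {m} \<inter> space M) * prob (?L m -` V \<inter> space M)" for m V
  proof -
    have L: "(\<lambda>f. map (\<lambda>k. f (k, Suc n)) [1..<Suc m])
        \<in> measurable (PiM ?B (\<lambda>_. count_space UNIV)) (count_space (UNIV :: nat list set))"
      by (rule measurable_map_list[where Y="\<lambda>k f. f (k, Suc n)"],
          rule measurable_component_singleton) auto
    show ?thesis
    proof (rule prob_disjoint_blocks[OF offspring_indep _ _ _ measurable_gw_path[OF order.refl] L])
      show "X n \<omega> = gw_path n (restrict (\<lambda>i. ?Y i \<omega>) ?A)" if "\<omega> \<in> space M" for \<omega>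
        unfolding X_eq_gw_path[OF that] by (rule gw_path_cong) auto
    qed (auto simp del: upt_Suc)
  qed
  have eq: "X (Suc n) \<omega> = sum_list (?L (X n \<omega>) \<omega>)" if "\<omega> \<in> space M" for \<omega>
    using that
    by (simp add: X_Suc interv_sum_list_conv_sum_set_nat atLeastLessThanSuc_atLeastAtMost del: upt_Suc)
  have mS: "random_variable (count_space UNIV) (\<lambda>\<omega>. sum_list (?L m \<omega>))" for m
    by (rule measurable_compose[OF mL]) simp
  have "random_variable (count_space UNIV) (X (Suc n)) \<longleftrightarrow>
      random_variable (count_space UNIV) (\<lambda>\<omega>. sum_list (?L (X n \<omega>) \<omega>))"
    by (intro measurable_cong eq)
  moreover have "random_variable (count_space UNIV) (\<lambda>\<omega>. sum_list (?L (X n \<omega>) \<omega>))"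
    by (rule measurable_compose_countable[OF mS]) (use Suc in auto)
  moreover have "distr M (count_space UNIV) (X (Suc n)) =
      distr M (count_space UNIV) (\<lambda>\<omega>. sum_list (?L (X n \<omega>) \<omega>))"
    by (intro distr_cong eq) auto
  moreover have "\<dots> = measure_pmf (bind_pmf (iterate_law p n) (\<lambda>m. map_pmf sum_list (replicate_pmf m p)))"
  proof (rule distr_random_choice[where T="X n" and Z="\<lambda>m \<omega>. sum_list (?L m \<omega>)"])
    show "distr M (count_space UNIV) (\<lambda>\<omega>. sum_list (?L m \<omega>)) = measure_pmf (map_pmf sum_list (replicate_pmf m p))" for m
      by (rule distr_compose_pmf[OF mL lawL])
    show "prob ((X n -` {m} \<inter> space M) \<inter> ((\<lambda>\<omega>. sum_list (?L m \<omega>)) -` B \<inter> space M)) =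
        prob (X n -` {m} \<inter> space M) * prob ((\<lambda>\<omega>. sum_list (?L m \<omega>)) -` B \<inter> space M)" for m B
      using ind[of m "sum_list -` B"] by (simp add: vimage_def del: upt_Suc)
  qed (use Suc mS in auto)
  ultimately show ?case
    by (simp add: iterate_law_Suc_right compound_def conv_power_replicate[abs_def] del: iterate_law.simps)
qed

end

section \<open>The law of the coagulation process\<close>

text \<open>Cuts \<open>xs\<close> into consecutive blocks of lengths \<open>ds\<close> and sums each block: one coagulation
  step, with merger sizes \<open>ds\<close>, as an operation on lists.\<close>

primrec block_sums :: "nat list \<Rightarrow> nat list \<Rightarrow> nat list" where
  "block_sums [] xs = []"
| "block_sums (d # ds) xs = sum_list (take d xs) # block_sums ds (drop d xs)"

text \<open>Independence is preserved by a coagulation step with independent merger sizes: the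
  block sums use disjoint parts of the list. The list is exactly long enough for all the
  blocks.\<close>

lemma block_sums_iid:
  "bind_pmf (replicate_pmf K p) (\<lambda>ds. map_pmf (block_sums ds) (replicate_pmf (sum_list ds) q))
     = replicate_pmf K (compound p q)"
proof (induction K)
  case (Suc K)
  have "bind_pmf (replicate_pmf (Suc K) p) (\<lambda>ds. map_pmf (block_sums ds) (replicate_pmf (sum_list ds) q))
     = bind_pmf p (\<lambda>d. bind_pmf (replicate_pmf K p) (\<lambda>ds. bind_pmf (replicate_pmf d q)
         (\<lambda>xs. map_pmf ((#) (sum_list xs) \<circ> block_sums ds) (replicate_pmf (sum_list ds) q))))"
    by (auto simp: bind_assoc_pmf bind_return_pmf replicate_pmf_distrib map_pmf_def set_replicate_pmf
        intro!: bind_pmf_cong)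
  also have "\<dots> = bind_pmf p (\<lambda>d. bind_pmf (replicate_pmf d q) (\<lambda>xs. bind_pmf (replicate_pmf K p)
         (\<lambda>ds. map_pmf ((#) (sum_list xs) \<circ> block_sums ds) (replicate_pmf (sum_list ds) q))))"
    by (subst bind_commute_pmf) simp
  also have "\<dots> = bind_pmf p (\<lambda>d. bind_pmf (replicate_pmf d q) (\<lambda>xs.
         map_pmf ((#) (sum_list xs)) (replicate_pmf K (compound p q))))"
    by (simp add: Suc[symmetric] map_bind_pmf pmf.map_comp)
  also have "\<dots> = replicate_pmf (Suc K) (compound p q)"
    by (simp add: compound_def conv_power_replicate[abs_def] bind_assoc_pmf bind_map_pmf map_pmf_def[of "(#) _"])
  finally show ?case .
qed (simp add: bind_return_pmf)

text \<open>The first block is the part of \<open>c\<close> between \<open>s a\<close> and \<open>s (Suc a)\<close>; monotonicity ensures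
  that the truncated differences are the lengths of the blocks.\<close>

lemma block_sums_intervals:
  fixes s c :: "nat \<Rightarrow> nat"
  assumes "mono s" "a \<le> b"
  shows "block_sums (map (\<lambda>k. s (Suc k) - s k) [a..<b]) (map c [Suc (s a)..<Suc (s b)]) =
    map (\<lambda>j. \<Sum>i = 1 + s (j - 1)..s j. c i) [Suc a..<Suc b]"
  using assms(2)
proof (induction a rule: inc_induct)
  case (step a)
  have s: "s a \<le> s (Suc a)" "s (Suc a) \<le> s b"
    using step by (auto intro!: monoD[OF assms(1)])
  have "[Suc (s a)..<Suc (s b)] = [Suc (s a)..<Suc (s (Suc a))] @ [Suc (s (Suc a))..<Suc (s b)]"
    using s upt_add_eq_append[of "Suc (s a)" "Suc (s (Suc a))" "s b - s (Suc a)"] by simp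
  moreover have "length [Suc (s a)..<Suc (s (Suc a))] = s (Suc a) - s a"
    by (simp del: upt_Suc)
  moreover have "[a..<b] = a # [Suc a..<b]" "[Suc a..<Suc b] = Suc a # [Suc (Suc a)..<Suc b]"
    using step by (auto simp: upt_conv_Cons simp del: upt_Suc)
  ultimately show ?case
    using step.IH
    by (simp add: interv_sum_list_conv_sum_set_nat atLeastLessThanSuc_atLeastAtMost del: upt_Suc)
qed simp

lemma sum_list_increments:
  fixes s :: "nat \<Rightarrow> nat"
  assumes "mono s"
  shows "sum_list (map (\<lambda>k. s (Suc k) - s k) [0..<b]) = s b - s 0"
  by (induction b) (use monoD[OF assms] in \<open>auto simp: le_SucI\<close>)

text \<open>Events expressed by variables that are measurable for the generated
  \<open>\<sigma>\<close>-algebra belong to it, which makes them accessible to \<open>S_indep_past\<close>.\<close>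

lemma generated_events_vimage:
  assumes "f \<in> measurable (sigma \<Omega> (\<Union>i\<in>I. {Y i -` A \<inter> \<Omega> | A. True})) (count_space UNIV)"
  shows "f -` B \<inter> \<Omega> \<in> generated_events \<Omega> Y I"
proof -
  have "(\<Union>i\<in>I. {Y i -` A \<inter> \<Omega> | A. True}) \<subseteq> Pow \<Omega>" by auto
  thus ?thesis
    using measurable_sets[OF assms, of B] by (simp add: generated_events_def space_measure_of_conv)
qed

lemma measurable_generating_family:
  assumes "i \<in> I"
  shows "Y i \<in> measurable (sigma \<Omega> (\<Union>i\<in>I. {Y i -` A \<inter> \<Omega> | A. True})) (count_space UNIV)"
  using assms by (intro measurableI) (auto simp: space_measure_of_conv intro!: in_measure_of)

lemma map_pmf_nth_replicate_pmf:
  "j < K \<Longrightarrow> map_pmf (\<lambda>xs. xs ! j) (replicate_pmf K q) = q"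
proof (induction K arbitrary: j)
  case (Suc K)
  thus ?case
    by (cases j) (simp_all add: map_pmf_def bind_assoc_pmf bind_return_pmf bind_return_pmf' )
qed simp

context coagulation
begin

lemma mono_S: "\<omega> \<in> space M \<Longrightarrow> mono (\<lambda>k. S k n \<omega>)"
  by (simp add: mono_iff_le_Suc S_mono)

lemma measurable_C: "i \<ge> 1 \<Longrightarrow> random_variable (count_space UNIV) (C n i)"
proof (rule measurableI)
  fix A assume "i \<ge> 1"
  have "C n i -` A \<inter> space M \<in> generated_events (space M) (\<lambda>(m, i). C m i) ({..n} \<times> {1..})"
    unfolding generated_events_def using \<open>i \<ge> 1\<close>
    by (intro sigma_sets.Basic UN_I[of "(n, i)"]) auto
  thus "C n i -` A \<inter> space M \<in> events"
    using indep_setD_ev2[OF S_indep_past] by auto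
qed simp

text \<open>The induction has to carry independence of the clusters along, not only their common
  law. The joint law of every initial segment expresses both. The merger sizes are the random
  index; once they are fixed, the new clusters are the block sums of an initial segment of the old
  ones, of a length that depends only on the sizes.\<close>

lemma distr_C_list:
  "distr M (count_space UNIV) (\<lambda>\<omega>. map (\<lambda>i. C n i \<omega>) [1..<Suc K]) =
     measure_pmf (replicate_pmf K (iterate_law p n))"
proof (induction n arbitrary: K)
  case 0
  have "distr M (count_space UNIV) (\<lambda>\<omega>. map (\<lambda>i. C 0 i \<omega>) [1..<Suc K])
      = distr M (count_space UNIV) (\<lambda>_. replicate K 1)"
    by (intro distr_cong) (auto simp: C_0 map_replicate_const[symmetric] intro!: nth_equalityI simp del: upt_Suc)
  also have "\<dots> = measure_pmf (return_pmf (replicate K 1))"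
    by (simp add: return_pmf.rep_eq)
  also have "return_pmf (replicate K 1) = replicate_pmf K (return_pmf (1::nat))" for K
  proof (induction K)
    case (Suc K)
    show ?case by (simp add: bind_return_pmf Suc[symmetric] del: One_nat_def)
  qed simp
  finally show ?case by simp
next
  case (Suc n)
  let ?D = "\<lambda>\<omega>. map (\<lambda>k. S (Suc k) n \<omega> - S k n \<omega>) [0..<K]"
  let ?L = "\<lambda>m \<omega>. map (\<lambda>i. C n i \<omega>) [1..<Suc m]"
  let ?Z = "\<lambda>ds \<omega>. block_sums ds (?L (sum_list ds) \<omega>)"
  have mL: "random_variable (count_space UNIV) (?L m)" for m
    by (rule measurable_map_list) (auto intro!: measurable_C)
  have mD: "random_variable (count_space UNIV) ?D"
    using increments_indep by (intro measurable_map_list) (auto simp: indep_vars_def)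
  have lawD: "distr M (count_space UNIV) ?D = measure_pmf (replicate_pmf K p)"
    using distr_iid_list[OF increments_indep increments_law, of "[0..<K]"] by simp
  let ?FS = "sigma (space M) (\<Union>k\<in>UNIV. {S k n -` A \<inter> space M | A. True})"
  let ?FC = "sigma (space M) (\<Union>i\<in>{..n} \<times> {1..}. {(case i of (m, i) \<Rightarrow> C m i) -` A \<inter> space M | A. True})"
  have FS: "?D \<in> measurable ?FS (count_space UNIV)"
  proof (rule measurable_map_list)
    fix k
    have "S k n \<in> measurable ?FS (count_space UNIV)" for k
      using measurable_generating_family[of k UNIV "\<lambda>k. S k n" "space M"] by simp
    thus "(\<lambda>\<omega>. S (Suc k) n \<omega> - S k n \<omega>) \<in> measurable ?FS (count_space UNIV)"
      by measurable
  qed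
  have FC: "?L m \<in> measurable ?FC (count_space UNIV)" for m
  proof (rule measurable_map_list)
    fix i assume "i \<in> set [1..<Suc m]"
    hence "(n, i) \<in> {..n} \<times> {1..}" by auto
    from measurable_generating_family[OF this, of "\<lambda>(m, i). C m i" "space M"]
    show "C n i \<in> measurable ?FC (count_space UNIV)" by (simp only: prod.case)
  qed
  have "distr M (count_space UNIV) (\<lambda>\<omega>. map (\<lambda>j. C (Suc n) j \<omega>) [1..<Suc K])
      = distr M (count_space UNIV) (\<lambda>\<omega>. ?Z (?D \<omega>) \<omega>)"
  proof (rule distr_cong)
    fix \<omega> assume \<omega>: "\<omega> \<in> space M"
    have "map (\<lambda>j. C (Suc n) j \<omega>) [1..<Suc K]
        = map (\<lambda>j. \<Sum>i = 1 + S (j - 1) n \<omega>..S j n \<omega>. C n i \<omega>) [Suc 0..<Suc K]"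
      using \<omega> by (simp add: C_Suc del: upt_Suc)
    also have "\<dots> = ?Z (?D \<omega>) \<omega>"
      using block_sums_intervals[OF mono_S[OF \<omega>], of 0 K n "\<lambda>i. C n i \<omega>"]
        sum_list_increments[OF mono_S[OF \<omega>], of n K] S_0[OF \<omega>, of n]
      by (simp del: upt_Suc)
    finally show "map (\<lambda>j. C (Suc n) j \<omega>) [1..<Suc K] = ?Z (?D \<omega>) \<omega>" .
  qed auto
  also have "\<dots> = measure_pmf (bind_pmf (replicate_pmf K p)
       (\<lambda>ds. map_pmf (block_sums ds) (replicate_pmf (sum_list ds) (iterate_law p n))))"
  proof (rule distr_random_choice[OF mD _ lawD])
    fix ds
    show "random_variable (count_space UNIV) (?Z ds)"
      by (rule measurable_compose[OF mL]) simp
    show "distr M (count_space UNIV) (?Z ds) =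
        measure_pmf (map_pmf (block_sums ds) (replicate_pmf (sum_list ds) (iterate_law p n)))"
      by (rule distr_compose_pmf[OF mL Suc.IH])
    fix B
    have "prob ((?D -` {ds} \<inter> space M) \<inter> (?L (sum_list ds) -` (block_sums ds -` B) \<inter> space M)) =
        prob (?D -` {ds} \<inter> space M) * prob (?L (sum_list ds) -` (block_sums ds -` B) \<inter> space M)"
      by (intro indep_setD[OF S_indep_past[of n]] generated_events_vimage FS FC)
    thus "prob ((?D -` {ds} \<inter> space M) \<inter> (?Z ds -` B \<inter> space M)) =
        prob (?D -` {ds} \<inter> space M) * prob (?Z ds -` B \<inter> space M)"
      by (simp add: vimage_def del: upt_Suc)
  qed
  also have "\<dots> = measure_pmf (replicate_pmf K (iterate_law p (Suc n)))"
    by (simp add: block_sums_iid)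
  finally show ?case .
qed

lemma distr_C:
  assumes "i \<ge> 1"
  shows "distr M (count_space UNIV) (C n i) = measure_pmf (iterate_law p n)"
proof -
  have "distr M (count_space UNIV) (\<lambda>\<omega>. (map (\<lambda>i. C n i \<omega>) [1..<Suc i]) ! (i - 1))
      = measure_pmf (map_pmf (\<lambda>xs. xs ! (i - 1)) (replicate_pmf i (iterate_law p n)))"
    by (rule distr_compose_pmf[OF _ distr_C_list], rule measurable_map_list) (auto intro!: measurable_C)
  thus ?thesis
    using assms by (simp add: map_pmf_nth_replicate_pmf nth_append del: upt_Suc)
qed

end

section \<open>Equality of the laws and the evolution equation\<close>

lemma mass_function_eq_pmf:
  assumes "Y \<in> measurable M (count_space UNIV)" "distr M (count_space UNIV) Y = measure_pmf q"
  shows "mass_function M Y = pmf q"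
proof
  fix j
  have "{\<omega> \<in> space M. Y \<omega> = j} = Y -` {j} \<inter> space M" by auto
  thus "mass_function M Y j = pmf q j"
    using assms(1) by (simp add: mass_function_def pmf.rep_eq measure_distr flip: assms(2))
qed

theorem proposition3p1:
  fixes M :: "'a measure" and N :: "'b measure" and p :: "nat pmf"
    and \<xi> :: "nat \<Rightarrow> nat \<Rightarrow> 'a \<Rightarrow> nat" and X :: "nat \<Rightarrow> 'a \<Rightarrow> nat"
    and S :: "nat \<Rightarrow> nat \<Rightarrow> 'b \<Rightarrow> nat" and C :: "nat \<Rightarrow> nat \<Rightarrow> 'b \<Rightarrow> nat"
  assumes GW: "galton_watson M p \<xi> X"
    and CP: "coagulation N p S C"
  shows "(\<forall>n. \<forall>i\<ge>1. distr M (count_space UNIV) (X n) = distr N (count_space UNIV) (C n i) \<and>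
            mass_function M (X n) = mass_function N (C n i)) \<and>
         (critical p \<longrightarrow> (\<forall>n. \<forall>j>0.
            ((\<lambda>k. R_hat p k (rho (mass_function M (X n))) * I_hat k (mass_function M (X n)) j)
              has_sum (mass_function M (X (Suc n)) j - mass_function M (X n) j)) {2..}))"
proof -
  interpret GW: galton_watson M p \<xi> X by (rule GW)
  interpret CP: coagulation N p S C by (rule CP)
  have X: "mass_function M (X n) = pmf (iterate_law p n)" for n
    using GW.distr_X by (blast intro: mass_function_eq_pmf)
  have C: "mass_function N (C n i) = pmf (iterate_law p n)" if "i \<ge> 1" for n i
    using that by (intro mass_function_eq_pmf CP.measurable_C CP.distr_C)
  have "((\<lambda>k. R_hat p k (rho (mass_function M (X n))) * I_hat k (mass_function M (X n)) j)
      has_sum (mass_function M (X (Suc n)) j - mass_function M (X n) j)) {2..}"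
    if "critical p" "j > 0" for n j
    using coagulation_equation[OF nn_mean_critical[OF that(1)], of "iterate_law p n" j]
      nn_mean_iterate_law[OF nn_mean_critical[OF that(1)], of n] that(2)
    by (simp add: X)
  thus ?thesis
    by (simp add: X C GW.distr_X CP.distr_C)
qed

end
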